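(* Let $(P,\leq,{}',0,1)$ be an orthogonal mlb-complete poset, and for $x,y\in P$ let $x\rightarrow y:=y\vee\operatorname{Max}L(x',y')=\{y\vee w\mid w\in\operatorname{Max}L(x',y')\}$. Then for all $x,y,z\in P$ the following hold: (i) $y\leq x\rightarrow y$; (ii) $x\leq y$ implies $y\rightarrow z\leq_1 x\rightarrow z$; (iii) $x\rightarrow y=y\vee y'$ if $x\leq y$; $x\rightarrow y=y\vee(x'\wedge y')$ if $x\perp y$; and $x\rightarrow y=x'\vee y$ if $y\leq x$; (iv) $(x\rightarrow y)\rightarrow y=y\vee\big(y'\wedge\operatorname{Min}U(x,y)\big)$; (v) $\big((x\rightarrow y)\rightarrow y\big)\rightarrow y=y\vee\Big(y'\wedge\big(y\vee\operatorname{Max}L(x',y')\big)\Big)$.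
   Context: For a poset $(P,\leq)$ and $A\subseteq P$, $L(A)=\{x\in P\mid x\leq a\text{ for all }a\in A\}$ and $U(A)=\{x\in P\mid a\leq x\text{ for all }a\in A\}$; $L(a,b)=L(\{a,b\})$, $U(a,b)=U(\{a,b\})$. $\operatorname{Max}A$ and $\operatorname{Min}A$ denote the sets of maximal and minimal elements of $A$. For $A,B\subseteq P$: $A\leq B$ means $x\leq y$ for all $x\in A$, $y\in B$; $A\leq_1 B$ means that for every $x\in A$ there is $y\in B$ with $x\leq y$. Elements are identified with the corresponding singletons. An antitone involution on $P$ is a unary operation ${}'$ with $x''=x$ such that $x\leq y$ implies $y'\leq x'$. Write $x\perp y$ if $x\leq y'$. An orthogonal poset is a bounded poset $(P,\leq,{}',0,1)$ with an antitone involution such that $x\perp y$ implies that the supremum $x\vee y$ exists. A poset is mlb-complete if for every finite subset $M$ and every lower bound $x$ of $M$ there is a maximal lower bound of $M$ above (or equal to) $x$. For $y\in P$ and $A\subseteq P$, $y\vee A:=\{y\vee a\mid a\in A\}$ and $y\wedge A:=\{y\wedge a\mid a\in A\}$, when all these suprema (infima) exist (in all expressions above they do, by orthogonality). The operator $\rightarrow\colon P^2\to 2^P$ is extended to subsets by $A\rightarrow B:=\bigcup_{a\in A,b\in B}(a\rightarrow b)$. *)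

theory Defs
  imports Main
begin

context order
begin

definition lower_bounds :: "'a set \<Rightarrow> 'a set" where
  "lower_bounds A = {x. \<forall>a\<in>A. x \<le> a}"

definition upper_bounds :: "'a set \<Rightarrow> 'a set" where
  "upper_bounds A = {x. \<forall>a\<in>A. a \<le> x}"

definition maximals :: "'a set \<Rightarrow> 'a set" where
  "maximals A = {m\<in>A. \<forall>x\<in>A. m \<le> x \<longrightarrow> x = m}"

definition minimals :: "'a set \<Rightarrow> 'a set" where
  "minimals A = {m\<in>A. \<forall>x\<in>A. x \<le> m \<longrightarrow> x = m}"

definition sets_le :: "'a set \<Rightarrow> 'a set \<Rightarrow> bool" where
  "sets_le A B \<longleftrightarrow> (\<forall>x\<in>A. \<forall>y\<in>B. x \<le> y)"

definition sets_le1 :: "'a set \<Rightarrow> 'a set \<Rightarrow> bool" where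
  "sets_le1 A B \<longleftrightarrow> (\<forall>x\<in>A. \<exists>y\<in>B. x \<le> y)"

definition is_sup :: "'a set \<Rightarrow> 'a \<Rightarrow> bool" where
  "is_sup A s \<longleftrightarrow> s \<in> upper_bounds A \<and> (\<forall>t\<in>upper_bounds A. s \<le> t)"

definition is_inf :: "'a set \<Rightarrow> 'a \<Rightarrow> bool" where
  "is_inf A s \<longleftrightarrow> s \<in> lower_bounds A \<and> (\<forall>t\<in>lower_bounds A. t \<le> s)"

text \<open>Suprema and infima are partial operations: \<open>join x y\<close> and \<open>meet x y\<close> are meaningful
  only where the supremum resp. infimum exists. In an orthogonal poset \<open>join x y\<close> is the
  supremum if \<open>x\<close> and \<open>y\<close> are orthogonal, and \<open>meet x y\<close> is the infimum if \<open>- x\<close> and \<open>- y\<close>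
  are; the lemmas \<open>defined_...\<close> below are the instances that make the operator \<open>imp\<close> and the
  identities about it meaningful.\<close>

definition join :: "'a \<Rightarrow> 'a \<Rightarrow> 'a" where
  "join x y = (THE s. is_sup {x, y} s)"

definition meet :: "'a \<Rightarrow> 'a \<Rightarrow> 'a" where
  "meet x y = (THE s. is_inf {x, y} s)"

definition join_set :: "'a \<Rightarrow> 'a set \<Rightarrow> 'a set" where
  "join_set y A = {join y a | a. a \<in> A}"

definition meet_set :: "'a \<Rightarrow> 'a set \<Rightarrow> 'a set" where
  "meet_set y A = {meet y a | a. a \<in> A}"

end

text \<open>The set \<open>M\<close> may be empty; the condition then says that every element lies below a
  maximal one.\<close>

class mlb_complete = order +
  assumes maximal_lower_bound_exists:
    "finite M \<Longrightarrow> x \<in> lower_bounds M \<Longrightarrow> \<exists>m\<in>maximals (lower_bounds M). x \<le> m"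

text \<open>The unary minus is the antitone involution.\<close>

class involution_poset = order + uminus +
  assumes compl_compl: "- (- x) = x"
    and compl_antitone: "x \<le> y \<Longrightarrow> - y \<le> - x"
begin

definition perp :: "'a \<Rightarrow> 'a \<Rightarrow> bool" where
  "perp x y \<longleftrightarrow> x \<le> - y"

definition imp :: "'a \<Rightarrow> 'a \<Rightarrow> 'a set" where
  "imp x y = join_set y (maximals (lower_bounds {- x, - y}))"

definition imp_set :: "'a set \<Rightarrow> 'a set \<Rightarrow> 'a set" where
  "imp_set A B = (\<Union>a\<in>A. \<Union>b\<in>B. imp a b)"

end

class orthogonal_poset = involution_poset + order_bot + order_top +
  assumes perp_sup_exists: "perp x y \<Longrightarrow> \<exists>s. is_sup {x, y} s"

lemma is_sup_pair_iff:
  "is_sup {x, y} (s::'a::order) \<longleftrightarrow> x \<le> s \<and> y \<le> s \<and> (\<forall>t. x \<le> t \<and> y \<le> t \<longrightarrow> s \<le> t)"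
  by (auto simp: is_sup_def upper_bounds_def)

lemma is_inf_pair_iff:
  "is_inf {x, y} (s::'a::order) \<longleftrightarrow> s \<le> x \<and> s \<le> y \<and> (\<forall>t. t \<le> x \<and> t \<le> y \<longrightarrow> t \<le> s)"
  by (auto simp: is_inf_def lower_bounds_def)

lemma join_eqI: "is_sup {x, y} (s::'a::order) \<Longrightarrow> join x y = s"
  unfolding join_def by (rule the_equality) (auto simp: is_sup_pair_iff intro: antisym)

lemma meet_eqI: "is_inf {x, y} (s::'a::order) \<Longrightarrow> meet x y = s"
  unfolding meet_def by (rule the_equality) (auto simp: is_inf_pair_iff intro: antisym)

context involution_poset
begin

lemma compl_le_swap: "x \<le> - y \<Longrightarrow> y \<le> - x"
  using compl_antitone[of x "- y"] by (simp add: compl_compl)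

lemma compl_le_swap2: "- x \<le> y \<Longrightarrow> - y \<le> x"
  using compl_antitone[of "- x" y] by (simp add: compl_compl)

end

lemma is_sup_join:
  fixes x y :: "'a::orthogonal_poset"
  assumes "perp x y"
  shows "is_sup {x, y} (join x y)"
  using perp_sup_exists[OF assms] join_eqI by metis

lemma is_inf_meet:
  fixes x y :: "'a::orthogonal_poset"
  assumes "perp (- x) (- y)"
  shows "is_inf {x, y} (meet x y)"
proof -
  obtain s where "is_sup {- x, - y} s"
    using perp_sup_exists[OF assms] by blast
  then have "- x \<le> s" "- y \<le> s" and least: "\<And>t. - x \<le> t \<Longrightarrow> - y \<le> t \<Longrightarrow> s \<le> t"
    by (auto simp: is_sup_pair_iff)
  moreover have "t \<le> - s" if "t \<le> x" "t \<le> y" for t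
    using least[of "- t"] that by (auto intro: compl_le_swap compl_antitone)
  ultimately have "is_inf {x, y} (- s)"
    by (auto simp: is_inf_pair_iff intro: compl_le_swap2)
  then show ?thesis
    using meet_eqI by metis
qed

lemma defined_imp:
  fixes x y :: "'a::orthogonal_poset"
  assumes "w \<in> maximals (lower_bounds {- x, - y})"
  shows "is_sup {y, w} (join y w)"
  using assms
  by (intro is_sup_join) (auto simp: perp_def maximals_def lower_bounds_def intro: compl_le_swap)

lemma defined_join_compl:
  fixes y :: "'a::orthogonal_poset"
  shows "is_sup {y, - y} (join y (- y))"
  by (intro is_sup_join) (simp add: perp_def compl_compl)

lemma defined_meet_compls:
  fixes x y :: "'a::orthogonal_poset"
  assumes "perp x y"
  shows "is_inf {- x, - y} (meet (- x) (- y))"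
  using assms by (intro is_inf_meet) (simp add: compl_compl)

lemma defined_join_meet_compls:
  fixes x y :: "'a::orthogonal_poset"
  assumes "perp x y"
  shows "is_sup {y, meet (- x) (- y)} (join y (meet (- x) (- y)))"
  using defined_meet_compls[OF assms]
  by (intro is_sup_join) (auto simp: perp_def is_inf_pair_iff intro: compl_le_swap)

lemma defined_join_compl_left:
  fixes x y :: "'a::orthogonal_poset"
  assumes "y \<le> x"
  shows "is_sup {- x, y} (join (- x) y)"
  using assms by (intro is_sup_join) (simp add: perp_def compl_antitone)

lemma defined_meet_above:
  fixes y u :: "'a::orthogonal_poset"
  assumes "y \<le> u"
  shows "is_inf {- y, u} (meet (- y) u)"
  using assms by (intro is_inf_meet) (simp add: perp_def compl_compl)

lemma defined_join_meet_above:
  fixes y u :: "'a::orthogonal_poset"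
  assumes "y \<le> u"
  shows "is_sup {y, meet (- y) u} (join y (meet (- y) u))"
  using defined_meet_above[OF assms]
  by (intro is_sup_join) (auto simp: perp_def is_inf_pair_iff intro: compl_le_swap)

lemma defined_minimals_above:
  "u \<in> minimals (upper_bounds {x, y}) \<Longrightarrow> y \<le> u"
  by (simp add: minimals_def upper_bounds_def)

lemma defined_imp_above:
  fixes x y :: "'a::orthogonal_poset"
  assumes "u \<in> join_set y (maximals (lower_bounds {- x, - y}))"
  shows "y \<le> u"
  using assms defined_imp[of _ x y] by (auto simp: join_set_def is_sup_pair_iff)

end

theory Submission
  imports Defs
begin

text \<open>For \<open>y \<le> c\<close> the operator degenerates to \<open>c \<rightarrow> y = y \<or> c'\<close>, and every element of a set
  \<open>x \<rightarrow> y\<close> lies above \<open>y\<close>. Hence applying \<open>\<rightarrow> y\<close> again means complementing the set elementwise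
  and joining with \<open>y\<close>; De Morgan's laws for sets then give the identities for iterated
  implications.\<close>

lemma join_commute: "join x y = join y (x::'a::order)"
  by (simp add: join_def insert_commute)

text \<open>The involution reverses the order, so it carries a supremum to an infimum. Orthogonality
  is what makes \<open>join x y\<close> a genuine supremum.\<close>

lemma compl_join:
  fixes x y :: "'a::orthogonal_poset"
  assumes "perp x y"
  shows "- join x y = meet (- x) (- y)"
proof (rule meet_eqI[symmetric])
  have sup: "x \<le> join x y" "y \<le> join x y" "\<And>t. x \<le> t \<Longrightarrow> y \<le> t \<Longrightarrow> join x y \<le> t"
    using is_sup_join[OF assms] by (auto simp: is_sup_pair_iff)
  show "is_inf {- x, - y} (- join x y)"
    using sup by (auto simp: is_inf_pair_iff intro: compl_antitone compl_le_swap)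
qed

lemma compl_meet:
  fixes x y :: "'a::orthogonal_poset"
  assumes "perp (- x) (- y)"
  shows "- meet x y = join (- x) (- y)"
  using compl_join[OF assms] by (metis compl_compl)

lemma compl_image_join_set:
  fixes y :: "'a::orthogonal_poset"
  assumes "\<And>a. a \<in> A \<Longrightarrow> perp y a"
  shows "uminus ` join_set y A = meet_set (- y) (uminus ` A)"
  using assms by (force simp: join_set_def meet_set_def compl_join)

lemma compl_image_meet_set:
  fixes y :: "'a::orthogonal_poset"
  assumes "\<And>a. a \<in> A \<Longrightarrow> perp (- y) (- a)"
  shows "uminus ` meet_set y A = join_set (- y) (uminus ` A)"
  using assms by (force simp: join_set_def meet_set_def compl_meet)

lemma compl_image_compl_image: "uminus ` uminus ` A = (A :: 'a::involution_poset set)"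
  by (simp add: image_image compl_compl)

lemma compl_in_lower_bounds_iff:
  fixes a :: "'a::involution_poset"
  shows "- a \<in> lower_bounds (uminus ` A) \<longleftrightarrow> a \<in> upper_bounds A"
  by (auto simp: lower_bounds_def upper_bounds_def intro: compl_antitone)
    (metis compl_antitone compl_compl)

lemma compl_image_minimals_upper_bounds:
  fixes A :: "'a::involution_poset set"
  shows "uminus ` minimals (upper_bounds A) = maximals (lower_bounds (uminus ` A))"
proof -
  have "- u \<in> maximals (lower_bounds (uminus ` A)) \<longleftrightarrow> u \<in> minimals (upper_bounds A)" for u
    unfolding maximals_def minimals_def mem_Collect_eq compl_in_lower_bounds_iff
    by (metis compl_antitone compl_compl compl_in_lower_bounds_iff)
  \<comment> \<open>The equivalence only speaks of elements of the form \<open>- u\<close>; every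
    maximal lower bound \<open>m\<close> has this form, with \<open>u = - m\<close>.\<close>
  then show ?thesis
    by (auto simp: image_iff) (metis compl_compl)
qed

text \<open>A greatest lower bound is the only maximal one. This collapses \<open>imp x y\<close> to
  a singleton in each of the three special cases.\<close>

lemma maximals_lower_bounds_pair:
  "is_inf {x, y} (s::'a::order) \<Longrightarrow> maximals (lower_bounds {x, y}) = {s}"
  by (auto simp: is_inf_pair_iff maximals_def lower_bounds_def intro: antisym)

lemma join_set_singleton [simp]: "join_set y {a} = {join y (a::'a::order)}"
  by (simp add: join_set_def)

lemma imp_below:
  fixes x y :: "'a::orthogonal_poset"
  assumes "y \<le> x"
  shows "imp x y = {join y (- x)}"
proof -
  have "is_inf {- x, - y} (- x)"
    using assms by (simp add: is_inf_pair_iff compl_antitone)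
  then show ?thesis
    by (simp add: imp_def maximals_lower_bounds_pair)
qed

lemma imp_above:
  fixes x y :: "'a::orthogonal_poset"
  assumes "x \<le> y"
  shows "imp x y = {join y (- y)}"
proof -
  have "is_inf {- x, - y} (- y)"
    using assms by (simp add: is_inf_pair_iff compl_antitone)
  then show ?thesis
    by (simp add: imp_def maximals_lower_bounds_pair)
qed

lemma imp_perp:
  fixes x y :: "'a::orthogonal_poset"
  assumes "perp x y"
  shows "imp x y = {join y (meet (- x) (- y))}"
  using maximals_lower_bounds_pair[OF defined_meet_compls[OF assms]] by (simp add: imp_def)

lemma imp_set_singleton_below:
  fixes y :: "'a::orthogonal_poset"
  assumes "\<And>a. a \<in> A \<Longrightarrow> y \<le> a"
  shows "imp_set A {y} = join_set y (uminus ` A)"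
  using assms by (auto simp: imp_set_def join_set_def imp_below)

lemma le_imp:
  fixes x y :: "'a::orthogonal_poset"
  assumes "a \<in> imp x y"
  shows "y \<le> a"
  using assms unfolding imp_def by (rule defined_imp_above)

text \<open>Since \<open>- y \<le> - x\<close>, passing from \<open>y\<close> to \<open>x\<close>
  enlarges the set of lower bounds. A bound \<open>w\<close> maximal in the smaller set need not
  stay maximal, but mlb-completeness puts a maximal \<open>m\<close> above it, and joining with
  \<open>z\<close> is monotone.\<close>

lemma imp_antitone_left:
  fixes x y z :: "'a::{orthogonal_poset, mlb_complete}"
  assumes "x \<le> y"
  shows "sets_le1 (imp y z) (imp x z)"
  unfolding sets_le1_def
proof
  fix a
  assume "a \<in> imp y z"
  then obtain w where w: "w \<in> maximals (lower_bounds {- y, - z})" and a: "a = join z w"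
    by (auto simp: imp_def join_set_def)
  have "w \<in> lower_bounds {- x, - z}"
    using w compl_antitone[OF assms] by (auto simp: maximals_def lower_bounds_def)
  then obtain m where m: "m \<in> maximals (lower_bounds {- x, - z})" "w \<le> m"
    using maximal_lower_bound_exists[of "{- x, - z}" w] by auto
  have "join z w \<le> join z m"
    using defined_imp[OF w] defined_imp[OF m(1)] m(2)
    by (auto simp: is_sup_pair_iff dest: order_trans)
  with a m(1) show "\<exists>b\<in>imp x z. a \<le> b"
    by (auto simp: imp_def join_set_def)
qed

lemma imp_set_imp:
  fixes x y :: "'a::orthogonal_poset"
  shows "imp_set (imp x y) {y} = join_set y (meet_set (- y) (minimals (upper_bounds {x, y})))"
proof -
  let ?M = "maximals (lower_bounds {- x, - y})"
  have "uminus ` imp x y = meet_set (- y) (uminus ` ?M)"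
    unfolding imp_def
    \<comment> \<open>Every \<open>w\<close> in \<open>?M\<close> lies below \<open>- y\<close>,
      hence is orthogonal to \<open>y\<close>.\<close>
    by (rule compl_image_join_set)
      (auto simp: maximals_def lower_bounds_def perp_def intro: compl_le_swap)
  also have "uminus ` ?M = minimals (upper_bounds {x, y})"
    \<comment> \<open>The duality between minimal upper and maximal lower bounds is read backwards,
      by complementing both of its sides.\<close>
    using compl_image_compl_image[of "minimals (upper_bounds {x, y})"]
    by (simp add: compl_image_minimals_upper_bounds)
  finally show ?thesis
    using imp_set_singleton_below[of "imp x y" y] le_imp by metis
qed

text \<open>All elements of the twice iterated implication again lie above \<open>y\<close>, so the
  third arrow complements them: two De Morgan steps turn \<open>y \<or> (y' \<and> u)\<close> into
  \<open>y' \<and> (y \<or> u')\<close>, where \<open>u'\<close> runs through the maximal lower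
  bounds.\<close>

lemma imp_set_imp_set_imp:
  fixes x y :: "'a::orthogonal_poset"
  shows "imp_set (imp_set (imp x y) {y}) {y} =
    join_set y (meet_set (- y) (join_set y (maximals (lower_bounds {- x, - y}))))"
proof -
  let ?N = "minimals (upper_bounds {x, y})"
  let ?B = "meet_set (- y) ?N"
  have y_le: "y \<le> u" if "u \<in> ?N" for u
    using that by (rule defined_minimals_above)
  have "perp y b" if "b \<in> ?B" for b
    using that defined_meet_above[OF y_le]
    by (auto simp: meet_set_def is_inf_pair_iff perp_def intro: compl_le_swap)
  then have "uminus ` join_set y ?B = meet_set (- y) (uminus ` ?B)"
    by (rule compl_image_join_set)
  also have "uminus ` ?B = join_set (- (- y)) (uminus ` ?N)"
    \<comment> \<open>The meets exist because \<open>y \<le> u\<close> makes \<open>y\<close>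
      orthogonal to \<open>- u\<close>.\<close>
    using y_le by (intro compl_image_meet_set) (simp add: perp_def compl_compl)
  also have "\<dots> = join_set y (maximals (lower_bounds {- x, - y}))"
    by (simp add: compl_image_minimals_upper_bounds compl_compl)
  finally have compl: "uminus ` join_set y ?B =
    meet_set (- y) (join_set y (maximals (lower_bounds {- x, - y})))" .
  have "y \<le> a" if "a \<in> join_set y ?B" for a
    using that defined_join_meet_above[OF y_le]
    by (auto simp: join_set_def meet_set_def is_sup_pair_iff)
  then have "imp_set (join_set y ?B) {y} = join_set y (uminus ` join_set y ?B)"
    by (rule imp_set_singleton_below)
  then show ?thesis
    by (simp only: imp_set_imp compl)
qed

theorem theorem3p2:
  fixes x y z :: "'a::{orthogonal_poset, mlb_complete}"
  shows "sets_le {y} (imp x y) \<and>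
    (x \<le> y \<longrightarrow> sets_le1 (imp y z) (imp x z)) \<and>
    (x \<le> y \<longrightarrow> imp x y = {join y (- y)}) \<and>
    (perp x y \<longrightarrow> imp x y = {join y (meet (- x) (- y))}) \<and>
    (y \<le> x \<longrightarrow> imp x y = {join (- x) y}) \<and>
    imp_set (imp x y) {y} = join_set y (meet_set (- y) (minimals (upper_bounds {x, y}))) \<and>
    imp_set (imp_set (imp x y) {y}) {y} =
      join_set y (meet_set (- y) (join_set y (maximals (lower_bounds {- x, - y}))))"
proof (intro conjI impI)
  show "sets_le {y} (imp x y)"
    by (simp add: sets_le_def le_imp)
  show "imp x y = {join (- x) y}" if "y \<le> x"
    using imp_below[OF that] by (simp add: join_commute)
qed (fact imp_antitone_left imp_above imp_perp imp_set_imp imp_set_imp_set_imp)+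

end
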